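(* Let $\hbar,c,g>0$ be constants, and let $L_B$ be a self-adjoint operator on $H_B$ with compact resolvent such that $L_B\ge\ell_B\,\mathrm{Id}$ for some $\ell_B>0$ and $\operatorname{Tr}(e^{-\tau L_B})<\infty$ for all $\tau>0$. For $\tau>0$ let $$\sigma_\tau:=\left(\frac{\hbar c}{g}\right)^{1/2}L_B^{3/4}e^{-\tau L_B/2}\,\xi,$$ where $\xi$ is Gaussian white noise on $H_B$, and let $$U_\tau:=\tfrac12\big\langle \sigma_\tau,\,g\,L_B^{-1}\sigma_\tau\big\rangle_{H_B}.$$ Then for every $\tau>0$, $$\mathbb{E}[U_\tau]=\frac{\hbar c}{2}\operatorname{Tr}\!\left(L_B^{1/2}e^{-\tau L_B}\right).$$
   Context: $H_B=L^2(B,d\mu_B)$, with $B$ a three-dimensional Riemannian manifold or compactified three-dimensional region. Write $L_Bu_j=\lambda_ju_j$ with $\{u_j\}_{j\ge1}$ an orthonormal basis of $H_B$ and $\ell_B\le\lambda_1\le\lambda_2\le\cdots$. Gaussian white noise $\xi$ (real or complex) is the formal series $\xi=\sum_{j\ge1}\xi_ju_j$, where $(\xi_j)$ are independent centered Gaussian random variables with $\mathbb{E}[\xi_i\overline{\xi_j}]=\delta_{ij}$ (an isonormal Gaussian process on $H_B$; the series need not converge in $H_B$). The heat-regularized source $\sigma_\tau$ is the $H_B$-valued Gaussian random variable with components $\langle u_j,\sigma_\tau\rangle=(\hbar c/g)^{1/2}\lambda_j^{3/4}e^{-\tau\lambda_j/2}\xi_j$; its covariance operator is $(\hbar c/g)L_B^{3/2}e^{-\tau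 L_B}$, which is trace class. *)

theory Defs
  imports "HOL-Probability.Probability"
begin

section \<open>Real or complex scalars\<close>

text \<open>
  The axioms force the field to be the reals (with trivial conjugation) or the complex numbers
  (with the usual one), so that both versions of the Hilbert space and of the noise are covered
  by one development.
\<close>

class real_or_complex = real_normed_field + banach + second_countable_topology +
  fixes sconj :: "'a \<Rightarrow> 'a"
    and re_part :: "'a \<Rightarrow> real"
  assumes sconj_add: "sconj (x + y) = sconj x + sconj y"
    and sconj_mult: "sconj (x * y) = sconj x * sconj y"
    and sconj_sconj: "sconj (sconj x) = x"
    and mult_sconj: "x * sconj x = (norm x)\<^sup>2 *\<^sub>R 1"
    and re_part: "(2 * re_part x) *\<^sub>R 1 = x + sconj x"

instantiation real :: real_or_complex
begin
definition sconj_real :: "real \<Rightarrow> real" where "sconj_real x = x"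
definition re_part_real :: "real \<Rightarrow> real" where "re_part_real x = x"
instance
  by standard (auto simp: sconj_real_def re_part_real_def power2_eq_square)
end

instantiation complex :: real_or_complex
begin
definition sconj_complex :: "complex \<Rightarrow> complex" where "sconj_complex = cnj"
definition re_part_complex :: "complex \<Rightarrow> real" where "re_part_complex = Re"
instance
proof
  fix x y :: complex
  show "x * sconj x = (norm x)\<^sup>2 *\<^sub>R 1"
    unfolding sconj_complex_def scaleR_conv_of_real mult_1_right
    by (rule complex_norm_square [symmetric])
  show "(2 * re_part x) *\<^sub>R 1 = x + sconj x"
    by (simp add: sconj_complex_def re_part_complex_def complex_eq_iff)
qed (simp_all add: sconj_complex_def)
end


section \<open>The Hilbert space $L^2(B, d\mu_B)$\<close>

definition L2_functions :: "'b measure \<Rightarrow> ('b \<Rightarrow> 'k::real_or_complex) set" where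
  "L2_functions M =
     {f. f \<in> borel_measurable M \<and> integrable M (\<lambda>x. (norm (f x))\<^sup>2)}"

text \<open>
  As \<open>L\<^sup>2\<close> of a measure space is not available as a type, the locale says that the type
  \<open>'h\<close> is that Hilbert space: \<open>cls f\<close> is the class of the function \<open>f\<close> modulo equality almost
  everywhere (that \<open>cls\<close> identifies exactly the a.e. equal functions follows from
  \<open>norm_eq\<close>). The inner product is conjugate linear in the first argument, so
  \<open>ip (u j) x\<close> is the \<open>j\<close>-th component of \<open>x\<close>.
\<close>

locale L2_space =
  fixes M :: "'b measure"
    and cls :: "('b \<Rightarrow> 'k::real_or_complex) \<Rightarrow> 'h::banach"
    and sc :: "'k \<Rightarrow> 'h \<Rightarrow> 'h"
    and ip :: "'h \<Rightarrow> 'h \<Rightarrow> 'k"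
  assumes cls_surj: "cls ` L2_functions M = UNIV"
    and cls_add: "\<And>f g. f \<in> L2_functions M \<Longrightarrow> g \<in> L2_functions M \<Longrightarrow>
          cls (\<lambda>x. f x + g x) = cls f + cls g"
    and cls_scale: "\<And>c f. f \<in> L2_functions M \<Longrightarrow> cls (\<lambda>x. c * f x) = sc c (cls f)"
    and ip_cls: "\<And>f g. f \<in> L2_functions M \<Longrightarrow> g \<in> L2_functions M \<Longrightarrow>
          ip (cls f) (cls g) = (\<integral>x. sconj (f x) * g x \<partial>M)"
    and sc_of_real: "\<And>r h. sc (of_real r) h = r *\<^sub>R h"
    and norm_eq: "\<And>h. norm h = sqrt (re_part (ip h h))"

definition orthonormal_basis ::
  "('k::real_or_complex \<Rightarrow> 'h::banach \<Rightarrow> 'h) \<Rightarrow> ('h \<Rightarrow> 'h \<Rightarrow> 'k) \<Rightarrow> (nat \<Rightarrow> 'h) \<Rightarrow> bool" where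
  "orthonormal_basis sc ip e \<longleftrightarrow>
     (\<forall>i j. ip (e i) (e j) = (if i = j then 1 else 0)) \<and>
     closure (module.span sc (range e)) = UNIV"


section \<open>Unbounded operators\<close>

text \<open>
  An unbounded operator is given by its domain \<open>D\<close> and a function \<open>L\<close> whose values outside
  \<open>D\<close> are irrelevant.
\<close>

definition linear_operator ::
  "('k::real_or_complex \<Rightarrow> 'h::banach \<Rightarrow> 'h) \<Rightarrow> 'h set \<Rightarrow> ('h \<Rightarrow> 'h) \<Rightarrow> bool" where
  "linear_operator sc D L \<longleftrightarrow>
     module.subspace sc D \<and>
     (\<forall>x\<in>D. \<forall>y\<in>D. L (x + y) = L x + L y) \<and>
     (\<forall>c. \<forall>x\<in>D. L (sc c x) = sc c (L x))"

text \<open>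
  The last conjunct says that the adjoint of \<open>L\<close>, whose graph consists of the pairs
  \<open>(y, z)\<close> on the left-hand side, is \<open>L\<close> itself, domain included.
\<close>

definition self_adjoint ::
  "('k::real_or_complex \<Rightarrow> 'h::banach \<Rightarrow> 'h) \<Rightarrow> ('h \<Rightarrow> 'h \<Rightarrow> 'k) \<Rightarrow>
   'h set \<Rightarrow> ('h \<Rightarrow> 'h) \<Rightarrow> bool" where
  "self_adjoint sc ip D L \<longleftrightarrow>
     linear_operator sc D L \<and> closure D = UNIV \<and>
     (\<forall>y z. (\<forall>x\<in>D. ip y (L x) = ip z x) \<longleftrightarrow> (y \<in> D \<and> z = L y))"

definition compact_resolvent ::
  "('k::real_or_complex \<Rightarrow> 'h::banach \<Rightarrow> 'h) \<Rightarrow> 'h set \<Rightarrow> ('h \<Rightarrow> 'h) \<Rightarrow> bool" where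
  "compact_resolvent sc D L \<longleftrightarrow>
     (\<exists>z. bij_betw (\<lambda>x. L x - sc z x) D UNIV \<and>
          (\<forall>S. bounded S \<longrightarrow> compact (closure (inv_into D (\<lambda>x. L x - sc z x) ` S))))"

definition bounded_below ::
  "('h::banach \<Rightarrow> 'h \<Rightarrow> 'k::real_or_complex) \<Rightarrow> 'h set \<Rightarrow> ('h \<Rightarrow> 'h) \<Rightarrow> real \<Rightarrow> bool" where
  "bounded_below ip D L l \<longleftrightarrow> (\<forall>x\<in>D. re_part (ip x (L x)) \<ge> l * (norm x)\<^sup>2)"

definition eigenbasis ::
  "('k::real_or_complex \<Rightarrow> 'h::banach \<Rightarrow> 'h) \<Rightarrow> ('h \<Rightarrow> 'h \<Rightarrow> 'k) \<Rightarrow> 'h set \<Rightarrow> ('h \<Rightarrow> 'h) \<Rightarrow>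
   (nat \<Rightarrow> 'h) \<Rightarrow> (nat \<Rightarrow> real) \<Rightarrow> bool" where
  "eigenbasis sc ip D L u lam \<longleftrightarrow>
     orthonormal_basis sc ip u \<and> mono lam \<and>
     (\<forall>j. u j \<in> D \<and> L (u j) = lam j *\<^sub>R u j)"

text \<open>
  The operator \<open>f(L)\<close> for the self-adjoint operator \<open>L\<close> with eigenbasis \<open>u\<close> and eigenvalues
  \<open>lam\<close>. It is meaningful at those \<open>x\<close> for which the series converges, which are all \<open>x\<close> when
  \<open>f\<close> is bounded on the spectrum.
\<close>

definition fun_calculus ::
  "('k::real_or_complex \<Rightarrow> 'h::banach \<Rightarrow> 'h) \<Rightarrow> ('h \<Rightarrow> 'h \<Rightarrow> 'k) \<Rightarrow> (nat \<Rightarrow> 'h) \<Rightarrow>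
   (nat \<Rightarrow> real) \<Rightarrow> (real \<Rightarrow> real) \<Rightarrow> 'h \<Rightarrow> 'h" where
  "fun_calculus sc ip u lam f x = (\<Sum>j. f (lam j) *\<^sub>R sc (ip (u j) x) (u j))"

definition op_powr ::
  "('k::real_or_complex \<Rightarrow> 'h::banach \<Rightarrow> 'h) \<Rightarrow> ('h \<Rightarrow> 'h \<Rightarrow> 'k) \<Rightarrow> (nat \<Rightarrow> 'h) \<Rightarrow>
   (nat \<Rightarrow> real) \<Rightarrow> real \<Rightarrow> 'h \<Rightarrow> 'h" where
  "op_powr sc ip u lam a = fun_calculus sc ip u lam (\<lambda>t. t powr a)"

definition heat_op ::
  "('k::real_or_complex \<Rightarrow> 'h::banach \<Rightarrow> 'h) \<Rightarrow> ('h \<Rightarrow> 'h \<Rightarrow> 'k) \<Rightarrow> (nat \<Rightarrow> 'h) \<Rightarrow>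
   (nat \<Rightarrow> real) \<Rightarrow> real \<Rightarrow> 'h \<Rightarrow> 'h" where
  "heat_op sc ip u lam s = fun_calculus sc ip u lam (\<lambda>t. exp (- s * t))"

text \<open>
  The trace is required to have the same value in every orthonormal basis. For a positive
  operator, \<open>finite_trace\<close> is the usual condition that the sum of the
  \<open>ip (e j) (T (e j))\<close> is finite.
\<close>

definition has_trace ::
  "('k::real_or_complex \<Rightarrow> 'h::banach \<Rightarrow> 'h) \<Rightarrow> ('h \<Rightarrow> 'h \<Rightarrow> 'k) \<Rightarrow> ('h \<Rightarrow> 'h) \<Rightarrow> 'k \<Rightarrow> bool" where
  "has_trace sc ip T t \<longleftrightarrow>
     (\<forall>e. orthonormal_basis sc ip e \<longrightarrow> ((\<lambda>j. ip (e j) (T (e j))) has_sum t) UNIV)"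

definition finite_trace ::
  "('k::real_or_complex \<Rightarrow> 'h::banach \<Rightarrow> 'h) \<Rightarrow> ('h \<Rightarrow> 'h \<Rightarrow> 'k) \<Rightarrow> ('h \<Rightarrow> 'h) \<Rightarrow> bool" where
  "finite_trace sc ip T \<longleftrightarrow> (\<exists>t. has_trace sc ip T t)"

definition op_trace ::
  "('k::real_or_complex \<Rightarrow> 'h::banach \<Rightarrow> 'h) \<Rightarrow> ('h \<Rightarrow> 'h \<Rightarrow> 'k) \<Rightarrow> ('h \<Rightarrow> 'h) \<Rightarrow> 'k" where
  "op_trace sc ip T = (THE t. has_trace sc ip T t)"


section \<open>Gaussian white noise\<close>

text \<open>Constants count as (degenerate) Gaussian random variables.\<close>

definition real_gaussian :: "'w measure \<Rightarrow> ('w \<Rightarrow> real) \<Rightarrow> bool" where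
  "real_gaussian P X \<longleftrightarrow>
     (\<exists>m. AE w in P. X w = m) \<or>
     (\<exists>m s. s > 0 \<and> distributed P lborel X (normal_density m s))"

text \<open>
  All real-linear functionals of the variable are Gaussian. For complex scalars this
  includes both circular complex Gaussian variables and real Gaussian variables.
\<close>

definition gaussian :: "'w measure \<Rightarrow> ('w \<Rightarrow> 'k::real_or_complex) \<Rightarrow> bool" where
  "gaussian P X \<longleftrightarrow>
     X \<in> borel_measurable P \<and> (\<forall>a. real_gaussian P (\<lambda>w. re_part (sconj a * X w)))"

definition white_noise_coefficients ::
  "'w measure \<Rightarrow> (nat \<Rightarrow> 'w \<Rightarrow> 'k::real_or_complex) \<Rightarrow> bool" where
  "white_noise_coefficients P \<xi> \<longleftrightarrow>
     prob_space.indep_vars P (\<lambda>_. borel) \<xi> UNIV \<and>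
     (\<forall>j. gaussian P (\<xi> j) \<and> (\<integral>w. \<xi> j w \<partial>P) = 0) \<and>
     (\<forall>i j. (\<integral>w. \<xi> i w * sconj (\<xi> j w) \<partial>P) = (if i = j then 1 else 0))"

text \<open>
  White noise is the formal series with terms \<open>\<xi> j \<cdot> u j\<close>, which diverges in the Hilbert
  space. An operator acts on it term by term.
\<close>

definition apply_to_noise ::
  "('k::real_or_complex \<Rightarrow> 'h::banach \<Rightarrow> 'h) \<Rightarrow> ('h \<Rightarrow> 'h) \<Rightarrow> (nat \<Rightarrow> 'h) \<Rightarrow>
   (nat \<Rightarrow> 'w \<Rightarrow> 'k) \<Rightarrow> 'w \<Rightarrow> 'h" where
  "apply_to_noise sc T u \<xi> w = (\<Sum>j. sc (\<xi> j w) (T (u j)))"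

definition source ::
  "('k::real_or_complex \<Rightarrow> 'h::banach \<Rightarrow> 'h) \<Rightarrow> ('h \<Rightarrow> 'h \<Rightarrow> 'k) \<Rightarrow> (nat \<Rightarrow> 'h) \<Rightarrow>
   (nat \<Rightarrow> real) \<Rightarrow> (nat \<Rightarrow> 'w \<Rightarrow> 'k) \<Rightarrow> real \<Rightarrow> real \<Rightarrow> real \<Rightarrow> real \<Rightarrow> 'w \<Rightarrow> 'h" where
  "source sc ip u lam \<xi> hbar c g \<tau> w =
     (hbar * c / g) powr (1/2) *\<^sub>R
       apply_to_noise sc (op_powr sc ip u lam (3/4) \<circ> heat_op sc ip u lam (\<tau> / 2)) u \<xi> w"

definition energy ::
  "('h::banach \<Rightarrow> 'h \<Rightarrow> 'k::real_or_complex) \<Rightarrow> 'h set \<Rightarrow> ('h \<Rightarrow> 'h) \<Rightarrow> real \<Rightarrow> 'h \<Rightarrow> 'k" where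
  "energy ip D L g \<sigma> = 1/2 * ip \<sigma> (g *\<^sub>R inv_into D L \<sigma>)"

end

theory Submission
  imports Defs
begin

text \<open>
  In the eigenbasis \<open>u\<close> all operators are diagonal, so the theorem reduces to one computation with
  scalar series. The source has the coefficients
  \<open>(hbar * c / g) powr (1/2) * lam j powr (3/4) * exp (- \<tau> * lam j / 2) * \<xi> j\<close>, and the inverse of \<open>L\<close>
  divides by \<open>lam j\<close>. Hence wherever the source converges, the energy is
  \<open>hbar * c / 2\<close> times the sum of \<open>m j * (norm (\<xi> j))\<^sup>2\<close>, where
  \<open>m j = lam j powr (1/2) * exp (- \<tau> * lam j)\<close> (\<open>energy_source\<close>). The variables
  \<open>(norm (\<xi> j))\<^sup>2\<close> have expectation \<open>1\<close>, so by monotone convergence the expected energy is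
  \<open>hbar * c / 2 * suminf m\<close> (\<open>weighted_series_expectation\<close>), and \<open>suminf m\<close> is the trace of the
  diagonal operator with eigenvalues \<open>m\<close> (\<open>has_trace_diagonal\<close>).

  Four points need an argument. Finiteness of the sums: a power of the eigenvalue is absorbed by
  half of the exponential, and the heat trace is finite at every positive time
  (\<open>summable_powr_heat\<close>). The trace must have the same value in every orthonormal basis, which is
  Tonelli's theorem for double series combined with Parseval's identity. The inverse of \<open>L\<close> is given
  only as the set-theoretic inverse of an unbounded operator; that the diagonal operator with
  entries \<open>1 / lam j\<close> maps into the domain and inverts \<open>L\<close> is a consequence of self-adjointness
  (\<open>ip_inverse_operator\<close>). Finally, the source converges only almost surely: an orthonormal series
  converges exactly when its coefficients are square summable, so the event of convergence is
  measurable, and on its complement the energy is a constant.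
\<close>


section \<open>Conjugation and real part\<close>

lemma of_real_re_part: "of_real (2 * re_part x) = (x::'k::real_or_complex) + sconj x"
  using re_part[of x] by (simp add: of_real_def)

lemma mult_sconj_of_real: "x * sconj x = of_real ((norm (x::'k::real_or_complex))\<^sup>2)"
  using mult_sconj[of x] by (simp add: of_real_def)

lemma sconj_zero [simp]: "sconj 0 = (0::'k::real_or_complex)"
  using sconj_add[of 0 "0::'k"] by simp

text \<open>
  Multiplicativity of the norm, applied to the axiom on \<open>x * sconj x\<close>, leaves no other value.
\<close>

lemma norm_sconj [simp]: "norm (sconj x) = norm (x::'k::real_or_complex)"
proof (cases "x = 0")
  case False
  have "norm x * norm (sconj x) = (norm x)\<^sup>2"
    by (metis mult_sconj_of_real norm_mult norm_of_real abs_of_nonneg zero_le_power2)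
  with False show ?thesis
    by (simp add: power2_eq_square)
qed simp

lemma sconj_of_real [simp]: "sconj (of_real r) = (of_real r :: 'k::real_or_complex)"
proof (cases "r = 0")
  case False
  have "of_real r * sconj (of_real r :: 'k) = of_real r * of_real r"
    using mult_sconj_of_real[of "of_real r :: 'k"] by (simp add: power2_eq_square)
  with False show ?thesis by simp
qed simp

text \<open>
  Together with the corresponding fact on the real part below, this lets integrals and series
  be conjugated and split without knowing which of the two fields is meant.
\<close>

lemma bounded_linear_sconj: "bounded_linear (sconj :: 'k::real_or_complex \<Rightarrow> 'k)"
proof (rule bounded_linear_intro[where K = 1])
  show "sconj (r *\<^sub>R x) = r *\<^sub>R sconj x" for r and x :: 'k
    by (simp add: scaleR_conv_of_real sconj_mult)
qed (simp_all add: sconj_add)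

lemma re_part_of_real [simp]: "re_part (of_real r :: 'k::real_or_complex) = r"
proof -
  have "of_real (2 * re_part (of_real r :: 'k)) = (of_real (2 * r) :: 'k)"
    by (subst of_real_re_part) simp
  then show ?thesis
    by (simp only: of_real_eq_iff)
qed

lemma bounded_linear_re_part: "bounded_linear (re_part :: 'k::real_or_complex \<Rightarrow> real)"
proof (rule bounded_linear_intro[where K = 1])
  fix x y :: 'k and r :: real
  have "of_real (2 * re_part (x + y)) = (of_real (2 * (re_part x + re_part y)) :: 'k)"
    using of_real_re_part[of x] of_real_re_part[of y]
    by (subst of_real_re_part) (simp add: sconj_add algebra_simps)
  then show "re_part (x + y) = re_part x + re_part y"
    by (simp only: of_real_eq_iff) simp
  have "of_real (2 * re_part (r *\<^sub>R x)) = of_real r * (of_real (2 * re_part x) :: 'k)"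
    by (subst (1 2) of_real_re_part)
       (simp add: scaleR_conv_of_real sconj_mult algebra_simps)
  also have "\<dots> = (of_real (2 * (r * re_part x)) :: 'k)" by simp
  finally show "re_part (r *\<^sub>R x) = r *\<^sub>R re_part x"
    by (simp only: of_real_eq_iff) simp
  have "norm (of_real (2 * re_part x) :: 'k) \<le> norm x + norm (sconj x)"
    unfolding of_real_re_part by (rule norm_triangle_ineq)
  then show "norm (re_part x) \<le> norm x * 1"
    by (simp del: of_real_mult)
qed


section \<open>Hilbert spaces over the scalars\<close>

text \<open>
  All facts about operators and traces are proved from these axioms. The type of vectors is only
  a real Banach space, so the scalar multiplication is a parameter; \<open>ip_self\<close> ties the given
  norm to the inner product, and \<open>sc_of_real\<close> ties the two scalar multiplications together.
\<close>

locale scalar_hilbert = module sc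
  for sc :: "'k::real_or_complex \<Rightarrow> 'h::banach \<Rightarrow> 'h" +
  fixes ip :: "'h \<Rightarrow> 'h \<Rightarrow> 'k"
  assumes sc_of_real: "sc (of_real r) x = r *\<^sub>R x"
    and ip_add_right: "ip x (y + z) = ip x y + ip x z"
    and ip_sc_right: "ip x (sc c y) = c * ip x y"
    and sconj_ip: "sconj (ip x y) = ip y x"
    and ip_self: "ip x x = of_real ((norm x)\<^sup>2)"
begin

lemma ip_add_left: "ip (x + y) z = ip x z + ip y z"
  by (metis ip_add_right sconj_ip sconj_add)

lemma ip_sc_left: "ip (sc c x) y = sconj c * ip x y"
  by (metis ip_sc_right sconj_ip sconj_mult)

lemma ip_scaleR_right: "ip x (r *\<^sub>R y) = r *\<^sub>R ip x y"
  by (metis ip_sc_right sc_of_real scaleR_conv_of_real)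

lemma ip_zero_right [simp]: "ip x 0 = 0"
  using ip_scaleR_right[of x 0 0] by simp

lemma ip_zero_left [simp]: "ip 0 x = 0"
  using sconj_ip[of x 0] by simp

lemma norm_sc [simp]: "norm (sc c x) = norm c * norm x"
proof -
  have "(of_real ((norm (sc c x))\<^sup>2) :: 'k) = c * sconj c * of_real ((norm x)\<^sup>2)"
    unfolding ip_self[symmetric] by (simp add: ip_sc_left ip_sc_right)
  also have "\<dots> = of_real ((norm c * norm x)\<^sup>2)"
    by (simp add: mult_sconj_of_real power_mult_distrib)
  finally show ?thesis
    by (simp only: of_real_eq_iff) (simp add: power2_eq_iff_nonneg)
qed

lemma pythagoras:
  assumes "ip x y = 0"
  shows "(norm (x + y))\<^sup>2 = (norm x)\<^sup>2 + (norm y)\<^sup>2"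
proof -
  have "ip y x = 0"
    using assms sconj_ip[of x y] by simp
  with assms have "(of_real ((norm (x + y))\<^sup>2) :: 'k) = of_real ((norm x)\<^sup>2 + (norm y)\<^sup>2)"
    unfolding of_real_add ip_self[symmetric] by (simp add: ip_add_left ip_add_right)
  then show ?thesis
    by (simp only: of_real_eq_iff)
qed

text \<open>
  The vector \<open>y\<close> splits into its projection on the line through \<open>x\<close> and a rest
  orthogonal to it; by Pythagoras the projection is no longer than \<open>y\<close>.
\<close>

lemma cauchy_schwarz: "norm (ip x y) \<le> norm x * norm y"
proof (cases "x = 0")
  case False
  define c where "c = ip x y / of_real ((norm x)\<^sup>2)"
  have split: "sc c x + (y - sc c x) = y" by simp
  have "ip x y = ip x (sc c x) + ip x (y - sc c x)"
    by (simp only: ip_add_right[symmetric] split)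
  moreover have "ip x (sc c x) = ip x y"
    using False by (simp add: ip_sc_right ip_self c_def)
  ultimately have "ip (sc c x) (y - sc c x) = 0"
    by (simp add: ip_sc_left)
  from pythagoras[OF this] have "(norm (sc c x))\<^sup>2 \<le> (norm y)\<^sup>2"
    by (simp add: split)
  then have "norm c * norm x \<le> norm y"
    using power2_le_imp_le by simp
  moreover have "norm c = norm (ip x y) / (norm x)\<^sup>2"
    by (simp add: c_def norm_divide norm_power)
  ultimately show ?thesis
    using False by (simp add: field_simps power2_eq_square)
qed simp

text \<open>
  Continuity of the inner product is what allows evaluating it term by term on a series.
\<close>

lemma bounded_linear_ip_right: "bounded_linear (ip x)"
proof (rule bounded_linear_intro[where K = "norm x"])
  show "norm (ip x y) \<le> norm y * norm x" for y
    using cauchy_schwarz[of x y] by (simp add: mult.commute)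
qed (simp_all add: ip_add_right ip_scaleR_right)

lemma bounded_linear_ip_left: "bounded_linear (\<lambda>x. ip x y)"
  using bounded_linear_compose[OF bounded_linear_sconj bounded_linear_ip_right[of y]]
  by (simp add: sconj_ip)

end


section \<open>Square integrable functions\<close>

lemma L2_functions_scale:
  assumes "f \<in> L2_functions M"
  shows "(\<lambda>x. c * f x) \<in> L2_functions M"
  using assms by (auto simp: L2_functions_def norm_mult power_mult_distrib)

lemma L2_functions_add:
  assumes "f \<in> L2_functions M" "g \<in> L2_functions M"
  shows "(\<lambda>x. f x + g x) \<in> L2_functions M"
proof -
  have [measurable]: "f \<in> borel_measurable M" "g \<in> borel_measurable M"
    using assms by (auto simp: L2_functions_def)
  have "integrable M (\<lambda>x. 2 * (norm (f x))\<^sup>2 + 2 * (norm (g x))\<^sup>2)"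
    using assms by (simp add: L2_functions_def)
  then have "integrable M (\<lambda>x. (norm (f x + g x))\<^sup>2)"
  proof (rule Bochner_Integration.integrable_bound)
    have "(norm (f x + g x))\<^sup>2 \<le> 2 * (norm (f x))\<^sup>2 + 2 * (norm (g x))\<^sup>2" for x
    proof -
      have "(norm (f x + g x))\<^sup>2 \<le> (norm (f x) + norm (g x))\<^sup>2"
        by (intro power_mono norm_triangle_ineq) simp
      also have "\<dots> \<le> 2 * (norm (f x))\<^sup>2 + 2 * (norm (g x))\<^sup>2"
        using sum_squares_bound[of "norm (f x)" "norm (g x)"] by (simp add: power2_sum)
      finally show ?thesis .
    qed
    then show "AE x in M. norm ((norm (f x + g x))\<^sup>2) \<le> norm (2 * (norm (f x))\<^sup>2 + 2 * (norm (g x))\<^sup>2)"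
      by simp
  qed measurable
  then show ?thesis
    by (simp add: L2_functions_def)
qed

text \<open>
  The product is dominated by the sum of the two squares.
\<close>

lemma L2_functions_integrable_mult:
  assumes "f \<in> L2_functions M" "g \<in> L2_functions M"
  shows "integrable M (\<lambda>x. sconj (f x) * g x)"
proof -
  have [measurable]: "f \<in> borel_measurable M" "g \<in> borel_measurable M"
    using assms by (auto simp: L2_functions_def)
  have [measurable]: "(\<lambda>x. sconj (f x)) \<in> borel_measurable M"
    by (rule borel_measurable_continuous_on[OF linear_continuous_on[OF bounded_linear_sconj]]) measurable
  have "integrable M (\<lambda>x. (norm (f x))\<^sup>2 + (norm (g x))\<^sup>2)"
    using assms by (simp add: L2_functions_def)
  then show ?thesis
  proof (rule Bochner_Integration.integrable_bound)
    have "norm (f x) * norm (g x) \<le> (norm (f x))\<^sup>2 + (norm (g x))\<^sup>2" for x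
      using sum_squares_bound[of "norm (f x)" "norm (g x)"]
        mult_nonneg_nonneg[OF norm_ge_zero norm_ge_zero, of "f x" "g x"]
      unfolding mult.assoc by linarith
    then show "AE x in M. norm (sconj (f x) * g x) \<le> norm ((norm (f x))\<^sup>2 + (norm (g x))\<^sup>2)"
      by (simp add: norm_mult)
  qed measurable
qed

text \<open>
  Every vector is the class of a square integrable function, so each axiom is an identity
  between integrals of representatives.
\<close>

lemma (in L2_space) scalar_hilbert: "scalar_hilbert sc ip"
proof -
  have rep: "\<exists>f. f \<in> L2_functions M \<and> h = cls f" for h
    using cls_surj by (metis UNIV_I imageE)
  note mem = L2_functions_scale L2_functions_add
  have "module sc"
  proof
    fix a b x y
    obtain f g where f: "f \<in> L2_functions M" "x = cls f" and g: "g \<in> L2_functions M" "y = cls g"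
      using rep by meson
    show "sc a (x + y) = sc a x + sc a y"
      using f g by (simp add: cls_add[symmetric] cls_scale[symmetric] mem distrib_left)
    show "sc (a + b) x = sc a x + sc b x"
      using f by (simp add: cls_add[symmetric] cls_scale[symmetric] mem distrib_right)
    show "sc a (sc b x) = sc (a * b) x"
      using f by (simp add: cls_scale[symmetric] mem mult.assoc)
    show "sc 1 x = x"
      using sc_of_real[of 1 x] by simp
  qed
  moreover have "scalar_hilbert_axioms sc ip"
  proof
    fix r c x y z
    obtain f g k where f: "f \<in> L2_functions M" "x = cls f" and g: "g \<in> L2_functions M" "y = cls g"
      and k: "k \<in> L2_functions M" "z = cls k"
      using rep by meson
    note int = L2_functions_integrable_mult
    show "sc (of_real r) x = r *\<^sub>R x"
      by (rule sc_of_real)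
    show "ip x (y + z) = ip x y + ip x z"
      using f g k by (simp add: cls_add[symmetric] ip_cls mem distrib_left int)
    have "ip x (sc c y) = (\<integral>t. c * (sconj (f t) * g t) \<partial>M)"
      using f g by (simp add: cls_scale[symmetric] ip_cls mem mult.left_commute)
    also have "\<dots> = c * ip x y"
      using f g by (simp add: ip_cls int)
    finally show "ip x (sc c y) = c * ip x y" .
    have "sconj (ip x y) = (\<integral>t. sconj (sconj (f t) * g t) \<partial>M)"
      using f g by (simp add: ip_cls int integral_bounded_linear[OF bounded_linear_sconj])
    then show "sconj (ip x y) = ip y x"
      using f g by (simp add: ip_cls sconj_mult sconj_sconj mult.commute)
    have "ip x x = (\<integral>t. of_real ((norm (f t))\<^sup>2) \<partial>M)"
      using f by (simp only: ip_cls mult_sconj_of_real[symmetric] mult.commute)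
    also have "\<dots> = of_real (\<integral>t. (norm (f t))\<^sup>2 \<partial>M)"
      by (rule integral_of_real) (use f in \<open>simp add: L2_functions_def\<close>)
    finally have r: "ip x x = of_real (\<integral>t. (norm (f t))\<^sup>2 \<partial>M)" .
    then have "(norm x)\<^sup>2 = (\<integral>t. (norm (f t))\<^sup>2 \<partial>M)"
      unfolding norm_eq by simp
    with r show "ip x x = of_real ((norm x)\<^sup>2)"
      by simp
  qed
  ultimately show ?thesis
    by (simp add: scalar_hilbert_def)
qed


section \<open>Expansion in orthonormal bases\<close>

context scalar_hilbert
begin

lemma ip_orthonormal_sum:
  assumes "\<forall>i j. ip (e i) (e j) = (if i = j then 1 else 0)" "finite A"
  shows "ip (e k) (\<Sum>j\<in>A. sc (c j) (e j)) = (if k \<in> A then c k else 0)"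
  using assms
  by (simp add: linear_sum[OF bounded_linear.linear[OF bounded_linear_ip_right]]
      ip_sc_right if_distrib[of "\<lambda>x. _ * x"] sum.delta cong: if_cong)

lemma norm_orthonormal_sum:
  assumes "\<forall>i j. ip (e i) (e j) = (if i = j then 1 else 0)" "finite A"
  shows "(norm (\<Sum>j\<in>A. sc (c j) (e j)))\<^sup>2 = (\<Sum>j\<in>A. (norm (c j))\<^sup>2)"
proof -
  let ?S = "\<Sum>j\<in>A. sc (c j) (e j)"
  have "ip ?S ?S = (\<Sum>j\<in>A. ip (sc (c j) (e j)) ?S)"
    by (rule linear_sum[OF bounded_linear.linear[OF bounded_linear_ip_left]])
  also have "\<dots> = (\<Sum>j\<in>A. c j * sconj (c j))"
    by (intro sum.cong refl)
       (simp add: ip_sc_left ip_orthonormal_sum[OF assms] mult.commute)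
  finally have "(of_real ((norm ?S)\<^sup>2) :: 'k) = of_real (\<Sum>j\<in>A. (norm (c j))\<^sup>2)"
    by (simp only: ip_self mult_sconj_of_real of_real_sum)
  then show ?thesis
    by (simp only: of_real_eq_iff)
qed

text \<open>
  If \<open>S\<close> denotes the projection, then \<open>ip S x\<close> is the square of the norm of \<open>S\<close>, and
  Cauchy-Schwarz bounds it by the product of the norms of \<open>S\<close> and \<open>x\<close>.
\<close>

lemma norm_orthonormal_projection_le:
  assumes "\<forall>i j. ip (e i) (e j) = (if i = j then 1 else 0)" "finite A"
  shows "norm (\<Sum>j\<in>A. sc (ip (e j) x) (e j)) \<le> norm x"
proof -
  let ?S = "\<Sum>j\<in>A. sc (ip (e j) x) (e j)"
  have "ip ?S x = (\<Sum>j\<in>A. ip (sc (ip (e j) x) (e j)) x)"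
    by (rule linear_sum[OF bounded_linear.linear[OF bounded_linear_ip_left]])
  also have "\<dots> = (\<Sum>j\<in>A. of_real ((norm (ip (e j) x))\<^sup>2))"
    by (simp only: ip_sc_left mult_sconj_of_real[symmetric] mult.commute)
  also have "\<dots> = of_real ((norm ?S)\<^sup>2)"
    by (simp only: norm_orthonormal_sum[OF assms] of_real_sum)
  finally have "(norm ?S)\<^sup>2 \<le> norm ?S * norm x"
    using cauchy_schwarz[of ?S x] by (simp del: of_real_power)
  then show ?thesis
    by (cases "norm ?S = 0") (auto simp: power2_eq_square)
qed

text \<open>
  The partial sum operators \<open>S n\<close> are eventually exact on each vector of the span, which is
  dense, and they are contractions; so the convergence passes to every vector by approximation.
\<close>

lemma orthonormal_basis_sums:
  assumes "orthonormal_basis sc ip e"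
  shows "(\<lambda>j. sc (ip (e j) x) (e j)) sums x"
proof -
  have e: "\<forall>i j. ip (e i) (e j) = (if i = j then 1 else 0)"
    and dense: "closure (span (range e)) = UNIV"
    using assms by (auto simp: orthonormal_basis_def)
  define S where "S n x = (\<Sum>j<n. sc (ip (e j) x) (e j))" for n x
  have S_le: "norm (S n x) \<le> norm x" for n x
    unfolding S_def by (rule norm_orthonormal_projection_le[OF e]) simp
  have S_diff: "S n (x - y) = S n x - S n y" for n x y
    by (simp add: S_def linear_diff[OF bounded_linear.linear[OF bounded_linear_ip_right]]
        scale_left_diff_distrib sum_subtractf)
  have on_span: "(\<lambda>n. S n y) \<longlonglongrightarrow> y" if "y \<in> span (range e)" for y
    using that
  proof (induction rule: span_induct_alt)
    case base
    show ?case by (simp add: S_def)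
  next
    case (step c x y)
    then obtain k where k: "x = e k" by auto
    have "\<forall>\<^sub>F n in sequentially. sc c x + S n y = S n (sc c x + y)"
      using eventually_gt_at_top[of k]
    proof eventually_elim
      case (elim n)
      have "S n (sc c x + y) = (\<Sum>j<n. sc (if j = k then c else 0) (e j)) + S n y"
        using e by (simp add: S_def ip_add_right ip_sc_right k scale_left_distrib sum.distrib
            if_distrib[of "\<lambda>x. c * x"] cong: if_cong)
      also have "(\<Sum>j<n. sc (if j = k then c else 0) (e j)) = sc c x"
        using elim by (simp add: if_distrib[of "\<lambda>c. sc c _"] k cong: if_cong)
      finally show ?case by simp
    qed
    then show ?case
      by (rule Lim_transform_eventually[OF tendsto_add[OF tendsto_const step.IH]])
  qed
  have "(\<lambda>n. S n x) \<longlonglongrightarrow> x"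
  proof (rule LIMSEQ_I)
    fix r :: real assume r: "r > 0"
    have "x \<in> closure (span (range e))" by (simp add: dense)
    then obtain y where y: "y \<in> span (range e)" and xy: "norm (x - y) < r / 3"
      using r unfolding closure_approachable by (metis dist_norm norm_minus_commute zero_less_divide_iff zero_less_numeral)
    obtain N where N: "\<And>n. n \<ge> N \<Longrightarrow> norm (S n y - y) < r / 3"
      using LIMSEQ_D[OF on_span[OF y], of "r / 3"] r by auto
    have "norm (S n x - x) < r" if "n \<ge> N" for n
    proof -
      have "S n x - x = S n (x - y) + (S n y - y) - (x - y)"
        by (simp add: S_diff)
      then have "norm (S n x - x) \<le> norm (S n (x - y)) + norm (S n y - y) + norm (x - y)"
        by (smt (verit) norm_triangle_ineq norm_triangle_ineq4)
      with S_le[of n "x - y"] N[OF that] xy show ?thesis by linarith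
    qed
    then show "\<exists>N. \<forall>n\<ge>N. norm (S n x - x) < r" by blast
  qed
  then show ?thesis
    by (simp add: sums_def S_def)
qed

lemma orthonormal_basis_eqI:
  assumes "orthonormal_basis sc ip e" "\<And>k. ip (e k) x = ip (e k) y"
  shows "x = y"
  using orthonormal_basis_sums[OF assms(1), of x] orthonormal_basis_sums[OF assms(1), of y]
  by (simp add: assms(2) sums_unique2)

lemma parseval:
  assumes "orthonormal_basis sc ip e"
  shows "(\<lambda>j. sconj (ip (e j) x) * ip (e j) y) sums ip x y"
  using bounded_linear.sums[OF bounded_linear_ip_right orthonormal_basis_sums[OF assms, of y], of x]
  by (simp add: ip_sc_right sconj_ip mult.commute)

lemma parseval_norm:
  assumes "orthonormal_basis sc ip e"
  shows "(\<lambda>j. (norm (ip (e j) x))\<^sup>2) sums (norm x)\<^sup>2"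
proof -
  have "(\<lambda>j. of_real ((norm (ip (e j) x))\<^sup>2) :: 'k) sums of_real ((norm x)\<^sup>2)"
    using parseval[OF assms, of x x]
    by (simp only: ip_self mult_sconj_of_real[symmetric] mult.commute)
  then show ?thesis
    by (simp only: sums_of_real_iff)
qed

text \<open>
  Completeness turns the Cauchy property of the squared coefficients into that of the series.
\<close>

lemma orthonormal_series_summable:
  assumes e: "orthonormal_basis sc ip e" and c: "summable (\<lambda>j. (norm (c j))\<^sup>2)"
  shows "summable (\<lambda>j. sc (c j) (e j))"
  unfolding summable_Cauchy
proof (intro allI impI)
  fix r :: real assume r: "r > 0"
  then obtain N where N: "\<And>m n. m \<ge> N \<Longrightarrow> norm (\<Sum>j\<in>{m..<n}. (norm (c j))\<^sup>2) < r\<^sup>2"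
    using c unfolding summable_Cauchy by (meson zero_less_power)
  have "norm (\<Sum>j\<in>{m..<n}. sc (c j) (e j)) < r" if "m \<ge> N" for m n
  proof -
    have "(norm (\<Sum>j\<in>{m..<n}. sc (c j) (e j)))\<^sup>2 = (\<Sum>j\<in>{m..<n}. (norm (c j))\<^sup>2)"
      by (rule norm_orthonormal_sum) (use e in \<open>auto simp: orthonormal_basis_def\<close>)
    also have "\<dots> < r\<^sup>2"
      using N[OF that, of n] by (simp add: sum_nonneg)
    finally show ?thesis
      using r by (simp add: power_less_imp_less_base)
  qed
  then show "\<exists>N. \<forall>m\<ge>N. \<forall>n. norm (\<Sum>j\<in>{m..<n}. sc (c j) (e j)) < r" by blast
qed

lemma ip_orthonormal_sums:
  assumes e: "orthonormal_basis sc ip e" and x: "(\<lambda>j. sc (c j) (e j)) sums x"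
  shows "ip (e k) x = c k"
proof -
  have "(\<lambda>j. ip (e k) (sc (c j) (e j))) sums ip (e k) x"
    by (rule bounded_linear.sums[OF bounded_linear_ip_right x])
  also have "(\<lambda>j. ip (e k) (sc (c j) (e j))) = (\<lambda>j. if j = k then c j else 0)"
    using e by (auto simp: orthonormal_basis_def ip_sc_right)
  finally show ?thesis
    using sums_single[of k c] sums_unique2 by blast
qed

text \<open>
  The equivalence describes the event on which the series of the source converges by a condition
  on real random variables. This is how its measurability is obtained.
\<close>

lemma orthonormal_series_summable_iff:
  assumes "orthonormal_basis sc ip e"
  shows "summable (\<lambda>j. sc (c j) (e j)) \<longleftrightarrow> summable (\<lambda>j. (norm (c j))\<^sup>2)"
proof
  assume "summable (\<lambda>j. sc (c j) (e j))"
  from summable_sums[OF this] parseval_norm[OF assms, of "\<Sum>j. sc (c j) (e j)"]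
  show "summable (\<lambda>j. (norm (c j))\<^sup>2)"
    by (simp add: ip_orthonormal_sums[OF assms] sums_iff)
qed (rule orthonormal_series_summable[OF assms])


section \<open>Diagonal operators and their trace\<close>

text \<open>
  The bound by the coefficients of a second vector \<open>y\<close> makes the defining series converge. A
  function bounded on the spectrum is covered by \<open>y = x\<close>; an unbounded power can be applied to
  \<open>x = h(L) y\<close> when \<open>h\<close> decays fast enough.
\<close>

lemma ip_fun_calculus:
  assumes u: "orthonormal_basis sc ip u"
    and f: "\<And>j. \<bar>f (lam j)\<bar> * norm (ip (u j) x) \<le> C * norm (ip (u j) y)"
  shows "ip (u k) (fun_calculus sc ip u lam f x) = of_real (f (lam k)) * ip (u k) x"
proof -
  let ?c = "\<lambda>j. of_real (f (lam j)) * ip (u j) x"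
  have "summable (\<lambda>j. C\<^sup>2 * (norm (ip (u j) y))\<^sup>2)"
    using parseval_norm[OF u, of y] by (intro summable_mult) (simp add: sums_iff)
  moreover have "(norm (?c j))\<^sup>2 \<le> C\<^sup>2 * (norm (ip (u j) y))\<^sup>2" for j
  proof -
    have "(norm (?c j))\<^sup>2 \<le> (C * norm (ip (u j) y))\<^sup>2"
      using f[of j] by (intro power_mono) (simp_all add: norm_mult)
    then show ?thesis by (simp add: power_mult_distrib)
  qed
  ultimately have "summable (\<lambda>j. (norm (?c j))\<^sup>2)"
    using summable_comparison_test'[where N = 0 and f = "\<lambda>j. (norm (?c j))\<^sup>2"
        and g = "\<lambda>j. C\<^sup>2 * (norm (ip (u j) y))\<^sup>2"] by simp
  then have "summable (\<lambda>j. sc (?c j) (u j))"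
    by (rule orthonormal_series_summable[OF u])
  moreover have "sc (?c j) (u j) = f (lam j) *\<^sub>R sc (ip (u j) x) (u j)" for j
    by (simp only: sc_of_real[symmetric] scale_scale)
  ultimately have "(\<lambda>j. sc (?c j) (u j)) sums fun_calculus sc ip u lam f x"
    by (simp add: fun_calculus_def summable_sums)
  then show ?thesis
    by (rule ip_orthonormal_sums[OF u])
qed

text \<open>
  In an orthonormal basis \<open>e\<close> the diagonal entry at \<open>e j\<close> is the sum over \<open>k\<close> of
  \<open>m k * (norm (ip (u k) (e j)))\<^sup>2\<close>. These numbers are nonnegative, so the double sum may be taken
  over \<open>j\<close> first; Parseval for \<open>e\<close> and the unit vector \<open>u k\<close> then gives \<open>m k\<close>. Hence the
  value does not depend on \<open>e\<close>.
\<close>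

lemma has_trace_diagonal:
  assumes u: "orthonormal_basis sc ip u"
    and T: "\<And>k x. ip (u k) (T x) = of_real (m k) * ip (u k) x"
    and m: "\<And>k. 0 \<le> m k" "summable m"
  shows "has_trace sc ip T (of_real (suminf m))"
  unfolding has_trace_def
proof (intro allI impI)
  fix e assume e: "orthonormal_basis sc ip e"
  define F where "F = (\<lambda>(k, j). m k * (norm (ip (u k) (e j)))\<^sup>2)"
  have unit: "norm x = 1" if "ip x x = 1" for x
    using that ip_self[of x] by (metis norm_ge_zero of_real_eq_1_iff power2_eq_1_iff le_minus_one_simps(3))
  \<comment> \<open>the sum over \<open>j\<close> for fixed \<open>k\<close>: Parseval in the basis \<open>e\<close>\<close>
  have col: "((\<lambda>j. F (k, j)) has_sum m k) UNIV" for k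
  proof -
    have "(\<lambda>j. (norm (ip (e j) (u k)))\<^sup>2) sums 1"
      using parseval_norm[OF e, of "u k"] u unit[of "u k"] by (simp add: orthonormal_basis_def)
    moreover have "norm (ip (e j) (u k)) = norm (ip (u k) (e j))" for j
      by (metis norm_sconj sconj_ip)
    ultimately have "(\<lambda>j. F (k, j)) sums m k"
      using sums_mult[of _ 1 "m k"] by (simp add: F_def)
    then show ?thesis
      by (rule sums_nonneg_imp_has_sum) (simp add: F_def m)
  qed
  \<comment> \<open>the sum over \<open>k\<close> for fixed \<open>j\<close>: Parseval in the basis \<open>u\<close>\<close>
  have row: "((\<lambda>k. F (k, j)) has_sum re_part (ip (e j) (T (e j)))) UNIV"
    and real: "ip (e j) (T (e j)) = of_real (re_part (ip (e j) (T (e j))))" for j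
  proof -
    have "(\<lambda>k. sconj (ip (u k) (e j)) * ip (u k) (T (e j))) sums ip (e j) (T (e j))"
      by (rule parseval[OF u])
    also have "(\<lambda>k. sconj (ip (u k) (e j)) * ip (u k) (T (e j))) = (\<lambda>k. of_real (F (k, j)))"
      by (auto simp: F_def T mult_sconj_of_real[symmetric] ac_simps simp del: of_real_power)
    finally have *: "(\<lambda>k. of_real (F (k, j))) sums ip (e j) (T (e j))" .
    have r: "(\<lambda>k. F (k, j)) sums re_part (ip (e j) (T (e j)))"
      using bounded_linear.sums[OF bounded_linear_re_part *] by simp
    then show "((\<lambda>k. F (k, j)) has_sum re_part (ip (e j) (T (e j)))) UNIV"
      by (rule sums_nonneg_imp_has_sum) (simp add: F_def m)
    show "ip (e j) (T (e j)) = of_real (re_part (ip (e j) (T (e j))))"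
      using sums_unique2[OF * sums_of_real[OF r]] .
  qed
  have sum_m: "(m has_sum suminf m) UNIV"
    using m by (intro sums_nonneg_imp_has_sum summable_sums)
  have "(F has_sum suminf m) (UNIV \<times> UNIV)"
  proof (rule has_sum_SigmaI[OF col sum_m])
    show "F summable_on UNIV \<times> UNIV"
      by (rule summable_on_SigmaI[OF col])
         (use sum_m m in \<open>auto simp: F_def summable_on_def\<close>)
  qed
  then have "((\<lambda>(j, k). F (k, j)) has_sum suminf m) (UNIV \<times> UNIV)"
    by (rule has_sum_swap[THEN iffD1])
  then have "((\<lambda>j. re_part (ip (e j) (T (e j)))) has_sum suminf m) UNIV"
    by (rule has_sum_SigmaD) (simp add: row)
  then show "((\<lambda>j. ip (e j) (T (e j))) has_sum of_real (suminf m)) UNIV"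
    by (subst real) (rule has_sum_of_real)
qed

lemma op_trace_eqI:
  assumes "orthonormal_basis sc ip u" "has_trace sc ip T t"
  shows "op_trace sc ip T = t"
  unfolding op_trace_def
proof (rule the_equality)
  fix t' assume "has_trace sc ip T t'"
  then have "((\<lambda>j. ip (u j) (T (u j))) has_sum t') UNIV"
    using assms(1) by (simp add: has_trace_def)
  moreover have "((\<lambda>j. ip (u j) (T (u j))) has_sum t) UNIV"
    using assms by (simp add: has_trace_def)
  ultimately show "t' = t"
    by (rule has_sum_unique)
qed (rule assms(2))

lemma summable_diagonal_of_finite_trace:
  assumes u: "orthonormal_basis sc ip u"
    and T: "\<And>k x. ip (u k) (T x) = of_real (m k) * ip (u k) x"
    and "finite_trace sc ip T"
  shows "summable m"
proof -
  obtain t where "((\<lambda>j. ip (u j) (T (u j))) has_sum t) UNIV"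
    using assms by (auto simp: finite_trace_def has_trace_def)
  moreover have "ip (u j) (T (u j)) = of_real (m j)" for j
    using u by (simp add: T orthonormal_basis_def)
  ultimately have "(\<lambda>j. of_real (m j) :: 'k) sums t"
    by (simp add: has_sum_imp_sums)
  from bounded_linear.sums[OF bounded_linear_re_part this]
  show ?thesis by (simp add: sums_iff)
qed


section \<open>The inverse of a positive self-adjoint operator\<close>

lemma bounded_below_inj:
  assumes "linear_operator sc D L" "bounded_below ip D L l" "l > 0"
  shows "inj_on L D"
proof (rule inj_onI)
  fix x y assume xy: "x \<in> D" "y \<in> D" "L x = L y"
  have sub: "subspace D" and add: "\<And>x y. x \<in> D \<Longrightarrow> y \<in> D \<Longrightarrow> L (x + y) = L x + L y"
    and scale: "\<And>c x. x \<in> D \<Longrightarrow> L (sc c x) = sc c (L x)"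
    using assms by (auto simp: linear_operator_def)
  have neg: "sc (- 1) y \<in> D"
    using sub xy by (intro subspace_scale)
  have "x - y \<in> D"
    using sub xy by (intro subspace_diff)
  moreover have "L (x - y) = L (x + sc (- 1) y)"
    by (simp add: scale_minus_left)
  then have "L (x - y) = 0"
    using xy neg by (simp only: add scale) (simp add: scale_minus_left)
  ultimately have "l * (norm (x - y))\<^sup>2 \<le> re_part (ip (x - y) 0)"
    using assms(2) unfolding bounded_below_def by metis
  also have "\<dots> = 0"
    using re_part_of_real[of 0, where 'k = 'k] by simp
  finally show "x = y"
    using \<open>l > 0\<close> by (simp add: mult_le_0_iff)
qed

text \<open>
  The candidate for the preimage of \<open>x\<close> is the vector \<open>y\<close> with coefficients
  \<open>ip (u k) x / lam k\<close>. That it lies in the domain follows from self-adjointness: the functional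
  \<open>z \<mapsto> ip y (L z)\<close> equals \<open>z \<mapsto> ip x z\<close> on \<open>D\<close>, since \<open>L\<close> multiplies the \<open>k\<close>-th coefficient of
  \<open>z\<close> by \<open>lam k\<close>, and so \<open>(y, x)\<close> belongs to the graph of the adjoint, which is \<open>L\<close>.
\<close>

lemma ip_inverse_operator:
  assumes "self_adjoint sc ip D L" "bounded_below ip D L l" "l > 0"
    and "eigenbasis sc ip D L u lam" "l \<le> lam 0"
  shows "ip x (inv_into D L x) = of_real (\<Sum>j. (norm (ip (u j) x))\<^sup>2 / lam j)"
proof -
  have u: "orthonormal_basis sc ip u" and uD: "\<And>j. u j \<in> D"
    and Lu: "\<And>j. L (u j) = lam j *\<^sub>R u j"
    using assms(4) by (auto simp: eigenbasis_def)
  have lam: "l \<le> lam j" for j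
    using assms(4,5) by (metis eigenbasis_def le0 monoD order_trans)
  have adj: "(\<forall>x\<in>D. ip y (L x) = ip z x) \<longleftrightarrow> (y \<in> D \<and> z = L y)" for y z
    using assms(1) by (simp add: self_adjoint_def)
  define y where "y = fun_calculus sc ip u lam (\<lambda>t. 1 / t) x"
  have y: "ip (u k) y = of_real (1 / lam k) * ip (u k) x" for k
    unfolding y_def
  proof (rule ip_fun_calculus[OF u])
    show "\<bar>1 / lam j\<bar> * norm (ip (u j) x) \<le> 1 / l * norm (ip (u j) x)" for j
      using lam[of j] \<open>l > 0\<close> by (intro mult_right_mono) (simp_all add: frac_le)
  qed
  have ev: "ip (u k) (L z) = of_real (lam k) * ip (u k) z" if "z \<in> D" for k z
  proof -
    have "ip (u k) (L z) = ip (L (u k)) z"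
      using adj[of "u k" "L (u k)"] uD that by blast
    also have "\<dots> = ip (sc (of_real (lam k)) (u k)) z"
      by (simp add: Lu sc_of_real)
    finally show ?thesis
      by (simp add: ip_sc_left)
  qed
  have "ip y (L z) = ip x z" if "z \<in> D" for z
  proof -
    have "sconj (ip (u k) y) * ip (u k) (L z) = sconj (ip (u k) x) * ip (u k) z" for k
    proof -
      have "lam k \<noteq> 0" using lam[of k] \<open>l > 0\<close> by simp
      then have "of_real (1 / lam k) * of_real (lam k) = (1 :: 'k)"
        by simp
      then show ?thesis
        unfolding y ev[OF that] sconj_mult sconj_of_real
        by (metis (no_types, lifting) mult.assoc mult.commute mult_1)
    qed
    then show ?thesis
      using parseval[OF u, of y "L z"] parseval[OF u, of x z] sums_unique2 by simp
  qed
  then have "y \<in> D" "x = L y"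
    using adj[of y x] by auto
  moreover have "inj_on L D"
    using bounded_below_inj[of D L l] assms by (simp add: self_adjoint_def)
  ultimately have inv: "inv_into D L x = y"
    by simp
  have "(\<lambda>k. sconj (ip (u k) x) * ip (u k) y) sums ip x y"
    by (rule parseval[OF u])
  also have "(\<lambda>k. sconj (ip (u k) x) * ip (u k) y)
      = (\<lambda>k. of_real ((norm (ip (u k) x))\<^sup>2 / lam k))"
  proof
    fix k
    have "sconj (ip (u k) x) * ip (u k) y = of_real (1 / lam k) * (ip (u k) x * sconj (ip (u k) x))"
      by (simp add: y ac_simps)
    then show "sconj (ip (u k) x) * ip (u k) y = of_real ((norm (ip (u k) x))\<^sup>2 / lam k)"
      by (simp add: mult_sconj_of_real)
  qed
  finally have *: "(\<lambda>k. of_real ((norm (ip (u k) x))\<^sup>2 / lam k)) sums ip x y" .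
  from bounded_linear.sums[OF bounded_linear_re_part *]
  have "summable (\<lambda>k. (norm (ip (u k) x))\<^sup>2 / lam k)"
    by (simp only: re_part_of_real sums_iff)
  from sums_of_real[OF summable_sums[OF this]] show ?thesis
    unfolding inv using * sums_unique2 by blast
qed

end


section \<open>Powers times the heat operator\<close>

text \<open>
  The right-hand side is the maximum over \<open>t\<close>, attained at \<open>t = a / s\<close>; the tangent of the
  logarithm at \<open>1\<close> gives the bound.
\<close>

lemma powr_mult_exp_le:
  fixes a s t :: real
  assumes "a > 0" "s > 0" "t > 0"
  shows "t powr a * exp (- s * t) \<le> exp (a * ln (a / s) - a)"
proof -
  have "ln (s * t / a) \<le> s * t / a - 1"
    using assms by (intro ln_le_minus_one) simp
  then have "a * ln (s * t / a) \<le> a * (s * t / a - 1)"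
    using assms by (intro mult_left_mono) simp_all
  then have "a * ln t - s * t \<le> a * ln (a / s) - a"
    using assms by (simp add: ln_div ln_mult algebra_simps)
  moreover have "t powr a * exp (- s * t) = exp (a * ln t - s * t)"
    using assms by (simp add: powr_def exp_add[symmetric])
  ultimately show ?thesis by simp
qed

context scalar_hilbert
begin

lemma ip_heat_op:
  assumes u: "orthonormal_basis sc ip u" and lam: "\<And>j. lam j > 0" and "s > 0"
  shows "ip (u k) (heat_op sc ip u lam s x) = of_real (exp (- s * lam k)) * ip (u k) x"
  unfolding heat_op_def
proof (rule ip_fun_calculus[OF u])
  show "\<bar>exp (- s * lam j)\<bar> * norm (ip (u j) x) \<le> 1 * norm (ip (u j) x)" for j
    using lam[of j] \<open>s > 0\<close> by (intro mult_right_mono) simp_all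
qed

lemma ip_powr_heat:
  assumes u: "orthonormal_basis sc ip u" and lam: "\<And>j. lam j > 0" and "a > 0" "s > 0"
  shows "ip (u k) ((op_powr sc ip u lam a \<circ> heat_op sc ip u lam s) x) =
    of_real (lam k powr a * exp (- s * lam k)) * ip (u k) x"
proof -
  note heat = ip_heat_op[OF u lam \<open>s > 0\<close>]
  have "ip (u k) (op_powr sc ip u lam a (heat_op sc ip u lam s x)) =
      of_real (lam k powr a) * ip (u k) (heat_op sc ip u lam s x)"
    unfolding op_powr_def
  proof (rule ip_fun_calculus[OF u])
    fix j
    have "\<bar>lam j powr a\<bar> * norm (ip (u j) (heat_op sc ip u lam s x)) =
        (lam j powr a * exp (- s * lam j)) * norm (ip (u j) x)"
      by (simp add: heat norm_mult)
    also have "\<dots> \<le> exp (a * ln (a / s) - a) * norm (ip (u j) x)"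
      using assms by (intro mult_right_mono powr_mult_exp_le) simp_all
    finally show "\<bar>lam j powr a\<bar> * norm (ip (u j) (heat_op sc ip u lam s x)) \<le>
      exp (a * ln (a / s) - a) * norm (ip (u j) x)" .
  qed
  then show ?thesis
    by (simp add: heat)
qed

lemma powr_heat_basis:
  assumes u: "orthonormal_basis sc ip u" and "\<And>j. lam j > 0" "a > 0" "s > 0"
  shows "(op_powr sc ip u lam a \<circ> heat_op sc ip u lam s) (u k) =
    sc (of_real (lam k powr a * exp (- s * lam k))) (u k)"
proof (rule orthonormal_basis_eqI[OF u])
  show "ip (u j) ((op_powr sc ip u lam a \<circ> heat_op sc ip u lam s) (u k)) =
      ip (u j) (sc (of_real (lam k powr a * exp (- s * lam k))) (u k))" for j
    using u by (simp only: ip_powr_heat[OF assms] ip_sc_right) (simp add: orthonormal_basis_def)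
qed

text \<open>
  Half of the exponential absorbs the power, and the other half is summable because the heat
  trace at time \<open>s / 2\<close> is finite.
\<close>

lemma summable_powr_heat:
  assumes u: "orthonormal_basis sc ip u" and lam: "\<And>j. lam j > 0"
    and heat: "\<And>\<tau>. \<tau> > 0 \<Longrightarrow> finite_trace sc ip (heat_op sc ip u lam \<tau>)"
    and "a > 0" "s > 0"
  shows "summable (\<lambda>k. lam k powr a * exp (- s * lam k))"
proof -
  let ?r = "s / 2"
  have "summable (\<lambda>k. exp (- ?r * lam k))"
  proof (rule summable_diagonal_of_finite_trace[OF u])
    show "ip (u k) (heat_op sc ip u lam ?r x) = of_real (exp (- ?r * lam k)) * ip (u k) x" for k x
      using ip_heat_op[OF u lam, of ?r] \<open>s > 0\<close> by simp
  qed (use heat \<open>s > 0\<close> in simp)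
  then have "summable (\<lambda>k. exp (a * ln (a / ?r) - a) * exp (- ?r * lam k))"
    by (rule summable_mult)
  then show ?thesis
  proof (rule summable_comparison_test'[where N = 0])
    fix k
    have "lam k powr a * exp (- s * lam k) = (lam k powr a * exp (- ?r * lam k)) * exp (- ?r * lam k)"
      by (simp add: exp_add[symmetric] mult.assoc)
    also have "\<dots> \<le> exp (a * ln (a / ?r) - a) * exp (- ?r * lam k)"
      using assms by (intro mult_right_mono powr_mult_exp_le) simp_all
    finally show "norm (lam k powr a * exp (- s * lam k)) \<le> exp (a * ln (a / ?r) - a) * exp (- ?r * lam k)"
      by simp
  qed
qed


section \<open>The energy of the source\<close>

text \<open>
  The \<open>j\<close>-th coefficient of the source is the noise \<open>\<xi> j w\<close> times the square root of
  \<open>(hbar * c / g) * lam j powr (3/2) * exp (- \<tau> * lam j)\<close>. In the quadratic form of the inverse its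
  square is divided by \<open>lam j\<close>, which lowers the exponent \<open>3/2\<close> to \<open>1/2\<close>, and the two factors \<open>g\<close>
  cancel. The hypothesis on \<open>w\<close> is the convergence of the source in the Hilbert space.
\<close>

lemma energy_source:
  assumes "self_adjoint sc ip D L" "bounded_below ip D L l" "l > 0"
    and eb: "eigenbasis sc ip D L u lam" and lam: "\<And>j. l \<le> lam j"
    and "hbar > 0" "c > 0" "g > 0" "\<tau> > 0"
    and summable: "summable (\<lambda>j. lam j powr (3/2) * exp (- \<tau> * lam j) * (norm (\<xi> j w))\<^sup>2)"
  shows "energy ip D L g (source sc ip u lam \<xi> hbar c g \<tau> w) =
    of_real (hbar * c / 2 * (\<Sum>j. lam j powr (1/2) * exp (- \<tau> * lam j) * (norm (\<xi> j w))\<^sup>2))"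
proof -
  have u: "orthonormal_basis sc ip u"
    using eb by (simp add: eigenbasis_def)
  have pos: "lam j > 0" for j
    using lam[of j] \<open>l > 0\<close> by simp
  define a where "a j = lam j powr (3/4) * exp (- (\<tau> / 2) * lam j)" for j
  define S where "S = apply_to_noise sc (op_powr sc ip u lam (3/4) \<circ> heat_op sc ip u lam (\<tau> / 2)) u \<xi> w"
  define K where "K = (hbar * c / g) powr (1/2)"
  have a2: "(a j)\<^sup>2 = lam j powr (3/2) * exp (- \<tau> * lam j)" for j
    by (simp add: a_def power2_eq_square mult_ac powr_add[symmetric] exp_add[symmetric])
  have K2: "K\<^sup>2 = hbar * c / g"
    using assms by (simp add: K_def power2_eq_square powr_add[symmetric])
  have "S = (\<Sum>j. sc (of_real (a j) * \<xi> j w) (u j))"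
    unfolding S_def apply_to_noise_def a_def
    using u pos \<open>\<tau> > 0\<close> by (subst powr_heat_basis) (simp_all add: mult.commute)
  moreover have "summable (\<lambda>j. sc (of_real (a j) * \<xi> j w) (u j))"
    using summable by (intro orthonormal_series_summable[OF u])
      (simp add: norm_mult power_mult_distrib a2)
  ultimately have S: "(\<lambda>j. sc (of_real (a j) * \<xi> j w) (u j)) sums S"
    by (simp add: summable_sums)
  have coeff: "(norm (ip (u j) S))\<^sup>2 / lam j = lam j powr (1/2) * exp (- \<tau> * lam j) * (norm (\<xi> j w))\<^sup>2" for j
  proof -
    have "lam j powr (3/2) = lam j powr (1/2) * lam j"
      using pos[of j] powr_add[of "lam j" "1/2" 1] by simp
    then show ?thesis
      using pos[of j]
      by (simp add: ip_orthonormal_sums[OF u S] norm_mult power_mult_distrib a2)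
  qed
  then have scaled: "(norm (ip (u j) (K *\<^sub>R S)))\<^sup>2 / lam j =
      hbar * c / g * (lam j powr (1/2) * exp (- \<tau> * lam j) * (norm (\<xi> j w))\<^sup>2)" for j
    by (simp add: ip_scaleR_right power_mult_distrib K2 times_divide_eq_right[symmetric]
        del: times_divide_eq_right)
  have sm: "summable (\<lambda>j. lam j powr (1/2) * exp (- \<tau> * lam j) * (norm (\<xi> j w))\<^sup>2)"
  proof -
    have "summable (\<lambda>j. (norm (ip (u j) S))\<^sup>2 / l)"
      using parseval_norm[OF u, of S] by (intro summable_divide) (simp add: sums_iff)
    then show ?thesis
    proof (rule summable_comparison_test'[where N = 0])
      fix j
      have "(norm (ip (u j) S))\<^sup>2 / lam j \<le> (norm (ip (u j) S))\<^sup>2 / l"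
        using lam[of j] \<open>l > 0\<close> by (intro divide_left_mono) simp_all
      then show "norm (lam j powr (1/2) * exp (- \<tau> * lam j) * (norm (\<xi> j w))\<^sup>2) \<le> (norm (ip (u j) S))\<^sup>2 / l"
        by (simp add: coeff)
    qed
  qed
  have "ip (K *\<^sub>R S) (inv_into D L (K *\<^sub>R S)) =
      of_real (\<Sum>j. hbar * c / g * (lam j powr (1/2) * exp (- \<tau> * lam j) * (norm (\<xi> j w))\<^sup>2))"
    using lam by (subst ip_inverse_operator[OF assms(1-4)]) (simp_all only: scaled)
  also have "\<dots> = of_real (hbar * c / g * (\<Sum>j. lam j powr (1/2) * exp (- \<tau> * lam j) * (norm (\<xi> j w))\<^sup>2))"
    by (simp only: suminf_mult[OF sm])
  finally have "energy ip D L g (K *\<^sub>R S) = of_real (1 / 2 * (g * (hbar * c / g *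
      (\<Sum>j. lam j powr (1/2) * exp (- \<tau> * lam j) * (norm (\<xi> j w))\<^sup>2))))"
    unfolding energy_def ip_scaleR_right scaleR_conv_of_real
    by (simp only: of_real_mult of_real_divide of_real_1 of_real_numeral)
  then show ?thesis
    using \<open>g > 0\<close> by (simp add: source_def K_def S_def del: of_real_mult of_real_divide)
qed

end


section \<open>Series of random variables\<close>

text \<open>
  By monotone convergence the series has the finite expectation \<open>suminf b\<close>, and therefore it is
  finite almost surely.
\<close>

lemma weighted_series_expectation:
  fixes X :: "nat \<Rightarrow> 'w \<Rightarrow> real"
  assumes X: "\<And>j. integrable P (X j)" "\<And>j w. 0 \<le> X j w" "\<And>j. (\<integral>w. X j w \<partial>P) = 1"
    and b: "\<And>j. 0 \<le> b j" "summable b"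
  shows "AE w in P. summable (\<lambda>j. b j * X j w)"
    and "integrable P (\<lambda>w. \<Sum>j. b j * X j w)"
    and "(\<integral>w. (\<Sum>j. b j * X j w) \<partial>P) = suminf b"
proof -
  have [measurable]: "X j \<in> borel_measurable P" for j
    using X by auto
  have "(\<integral>\<^sup>+w. (\<Sum>j. ennreal (b j * X j w)) \<partial>P) = (\<Sum>j. \<integral>\<^sup>+w. ennreal (b j * X j w) \<partial>P)"
    by (rule nn_integral_suminf) measurable
  also have "\<dots> = (\<Sum>j. ennreal (b j))"
    using X b by (subst nn_integral_eq_integral) simp_all
  also have "\<dots> \<noteq> \<infinity>"
    using b by (simp add: suminf_ennreal2)
  finally have "AE w in P. (\<Sum>j. ennreal (b j * X j w)) \<noteq> \<infinity>"
    by (intro nn_integral_noteq_infinite) measurable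
  then show ae: "AE w in P. summable (\<lambda>j. b j * X j w)"
    by eventually_elim (rule summable_suminf_not_top, use X b in auto)
  have "summable (\<lambda>j. \<integral>w. norm (b j * X j w) \<partial>P)" "AE w in P. summable (\<lambda>j. norm (b j * X j w))"
    "\<And>j. integrable P (\<lambda>w. b j * X j w)"
    using X b ae by simp_all
  note * = this(3,2,1)
  show "integrable P (\<lambda>w. \<Sum>j. b j * X j w)"
    by (rule integrable_suminf[OF *])
  show "(\<integral>w. (\<Sum>j. b j * X j w) \<partial>P) = suminf b"
    using integral_suminf[OF *] X by simp
qed

lemma measurable_summable:
  fixes f :: "nat \<Rightarrow> 'w \<Rightarrow> 'a::{banach, second_countable_topology}"
  assumes [measurable]: "\<And>j. f j \<in> borel_measurable P"
  shows "Measurable.pred P (\<lambda>w. summable (\<lambda>j. f j w))"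
  unfolding summable_iff_convergent Cauchy_convergent_iff[symmetric] pred_def
  by measurable

text \<open>
  Integrability can be read off from the normalisation: the integral of a function that is not
  integrable is \<open>0\<close> by convention, which differs from \<open>1\<close>.
\<close>

lemma white_noise_norm_sq:
  fixes \<xi> :: "nat \<Rightarrow> 'w \<Rightarrow> 'k::real_or_complex"
  assumes "white_noise_coefficients P \<xi>"
  shows "integrable P (\<lambda>w. (norm (\<xi> j w))\<^sup>2)" "(\<integral>w. (norm (\<xi> j w))\<^sup>2 \<partial>P) = 1"
proof -
  have one: "(\<integral>w. (of_real ((norm (\<xi> j w))\<^sup>2) :: 'k) \<partial>P) = 1"
    using assms by (simp add: white_noise_coefficients_def mult_sconj_of_real[symmetric] del: of_real_power)
  then have "integrable P (\<lambda>w. (of_real ((norm (\<xi> j w))\<^sup>2) :: 'k))"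
    using not_integrable_integral_eq by fastforce
  from integrable_bounded_linear[OF bounded_linear_re_part this]
  show int: "integrable P (\<lambda>w. (norm (\<xi> j w))\<^sup>2)"
    by (simp only: re_part_of_real)
  from one show "(\<integral>w. (norm (\<xi> j w))\<^sup>2 \<partial>P) = 1"
    unfolding integral_of_real[OF int] by (simp only: of_real_eq_1_iff)
qed


section \<open>The expected energy\<close>

theorem theorem5p2:
  fixes B :: "'b measure"
    and cls :: "('b \<Rightarrow> 'k::real_or_complex) \<Rightarrow> 'h::banach"
    and sc :: "'k \<Rightarrow> 'h \<Rightarrow> 'h"
    and ip :: "'h \<Rightarrow> 'h \<Rightarrow> 'k"
    and D :: "'h set" and L :: "'h \<Rightarrow> 'h"
    and u :: "nat \<Rightarrow> 'h" and lam :: "nat \<Rightarrow> real"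
    and P :: "'w measure" and \<xi> :: "nat \<Rightarrow> 'w \<Rightarrow> 'k"
    and hbar c g l :: real
  assumes "hbar > 0" and "c > 0" and "g > 0"
    and "L2_space B cls sc ip"
    and "self_adjoint sc ip D L"
    and "compact_resolvent sc D L"
    and "l > 0" and "bounded_below ip D L l"
    and "eigenbasis sc ip D L u lam" and "l \<le> lam 0"
    and "\<And>\<tau>. \<tau> > 0 \<Longrightarrow> finite_trace sc ip (heat_op sc ip u lam \<tau>)"
    and "prob_space P"
    and "white_noise_coefficients P \<xi>"
  shows "\<forall>\<tau>>0.
    integrable P (\<lambda>w. energy ip D L g (source sc ip u lam \<xi> hbar c g \<tau> w)) \<and>
    finite_trace sc ip (op_powr sc ip u lam (1/2) \<circ> heat_op sc ip u lam \<tau>) \<and>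
    (\<integral>w. energy ip D L g (source sc ip u lam \<xi> hbar c g \<tau> w) \<partial>P) =
      of_real (hbar * c / 2) * op_trace sc ip (op_powr sc ip u lam (1/2) \<circ> heat_op sc ip u lam \<tau>)"
proof (intro allI impI)
  fix \<tau> :: real assume \<tau>: "\<tau> > 0"
  interpret L2: L2_space B cls sc ip by fact
  interpret scalar_hilbert sc ip by (rule L2.scalar_hilbert)
  have u: "orthonormal_basis sc ip u" and mono: "mono lam"
    using assms(9) by (auto simp: eigenbasis_def)
  have lam: "l \<le> lam j" for j
    using monoD[OF mono, of 0 j] \<open>l \<le> lam 0\<close> by simp
  have pos: "lam j > 0" for j
    using lam[of j] \<open>l > 0\<close> by simp
  \<comment> \<open>\<open>m\<close> are the eigenvalues of the operator whose trace is claimed, \<open>b\<close> up to the factor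
    \<open>hbar * c / g\<close> those of the covariance of the source\<close>
  define m where "m j = lam j powr (1/2) * exp (- \<tau> * lam j)" for j
  define b where "b j = lam j powr (3/2) * exp (- \<tau> * lam j)" for j
  define T where "T = op_powr sc ip u lam (1/2) \<circ> heat_op sc ip u lam \<tau>"
  define U where "U w = energy ip D L g (source sc ip u lam \<xi> hbar c g \<tau> w)" for w
  have m: "0 \<le> m j" "summable m" and b: "0 \<le> b j" "summable b" for j
    unfolding m_def[abs_def] b_def[abs_def]
    using summable_powr_heat[OF u pos assms(11)] \<tau> by simp_all

  have tr: "has_trace sc ip T (of_real (suminf m))"
    using has_trace_diagonal[OF u _ m] ip_powr_heat[OF u pos _ \<tau>] unfolding T_def m_def
    by simp

  note X = white_noise_norm_sq[OF assms(13)]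
  note series = weighted_series_expectation[where X = "\<lambda>j w. (norm (\<xi> j w))\<^sup>2", OF X(1) zero_le_power2 X(2)]
  let ?V = "\<lambda>w. of_real (hbar * c / 2 * (\<Sum>j. m j * (norm (\<xi> j w))\<^sup>2)) :: 'k"
  have V: "integrable P ?V" "(\<integral>w. ?V w \<partial>P) = of_real (hbar * c / 2 * suminf m)"
  proof -
    have "integrable P (\<lambda>w. hbar * c / 2 * (\<Sum>j. m j * (norm (\<xi> j w))\<^sup>2))"
      "(\<integral>w. hbar * c / 2 * (\<Sum>j. m j * (norm (\<xi> j w))\<^sup>2) \<partial>P) = hbar * c / 2 * suminf m"
      using series(2,3)[OF m] by simp_all
    then show "integrable P ?V" "(\<integral>w. ?V w \<partial>P) = of_real (hbar * c / 2 * suminf m)"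
      by (simp_all only: integrable_of_real integral_of_real)
  qed

  \<comment> \<open>Where the series of the source diverges, its sum is one fixed unspecified vector. Hence the
    energy is constant on that null set, and \<open>U\<close> is measurable even if \<open>P\<close> is not complete.\<close>
  define C where "C = energy ip D L g ((hbar * c / g) powr (1/2) *\<^sub>R (THE s. False))"
  have U: "U w = (if summable (\<lambda>j. b j * (norm (\<xi> j w))\<^sup>2) then ?V w else C)" for w
  proof (cases "summable (\<lambda>j. b j * (norm (\<xi> j w))\<^sup>2)")
    case True
    then show ?thesis
      unfolding U_def b_def m_def
      by (simp only: energy_source[OF assms(5,8,7,9) lam assms(1-3) \<tau>] if_True)
  next
    case False
    let ?a = "\<lambda>j. lam j powr (3/4) * exp (- (\<tau> / 2) * lam j)"
    have "(?a j)\<^sup>2 = b j" for j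
      by (simp add: b_def power2_eq_square mult_ac powr_add[symmetric] exp_add[symmetric])
    with False have "\<not> summable (\<lambda>j. sc (\<xi> j w * of_real (?a j)) (u j))"
      unfolding orthonormal_series_summable_iff[OF u]
      by (simp add: norm_mult power_mult_distrib mult.commute del: of_real_mult)
    then have "apply_to_noise sc (op_powr sc ip u lam (3/4) \<circ> heat_op sc ip u lam (\<tau> / 2)) u \<xi> w = (THE s. False)"
      unfolding apply_to_noise_def using u pos \<tau>
      by (subst powr_heat_basis) (simp_all add: suminf_def summable_def)
    with False show ?thesis
      by (simp add: U_def source_def C_def)
  qed
  have \<xi> [measurable]: "\<xi> j \<in> borel_measurable P" for j
    using assms(13) by (simp add: white_noise_coefficients_def gaussian_def)
  have [measurable]: "Measurable.pred P (\<lambda>w. summable (\<lambda>j. b j * (norm (\<xi> j w))\<^sup>2))"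
    by (rule measurable_summable) measurable
  have VM [measurable]: "?V \<in> borel_measurable P"
    using V(1) by (rule borel_measurable_integrable)
  have UM: "U \<in> borel_measurable P"
    unfolding U[abs_def] by (intro measurable_If VM) measurable
  have ae: "AE w in P. U w = ?V w"
    using series(1)[OF b] by eventually_elim (simp add: U)
  have "integrable P U" "(\<integral>w. U w \<partial>P) = of_real (hbar * c / 2 * suminf m)"
    using V integrable_cong_AE[OF UM VM ae] integral_cong_AE[OF UM VM ae] by simp_all
  moreover have "finite_trace sc ip T"
    using tr by (auto simp: finite_trace_def)
  moreover have "op_trace sc ip T = of_real (suminf m)"
    by (rule op_trace_eqI[OF u tr])
  ultimately show "integrable P (\<lambda>w. energy ip D L g (source sc ip u lam \<xi> hbar c g \<tau> w)) \<and>
    finite_trace sc ip (op_powr sc ip u lam (1/2) \<circ> heat_op sc ip u lam \<tau>) \<and>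
    (\<integral>w. energy ip D L g (source sc ip u lam \<xi> hbar c g \<tau> w) \<partial>P) =
      of_real (hbar * c / 2) * op_trace sc ip (op_powr sc ip u lam (1/2) \<circ> heat_op sc ip u lam \<tau>)"
    by (simp add: U_def[abs_def] T_def)
qed

end
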